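(* Let $b:\mathbb{R}\to(0,\infty)$ be a positive function and let $(X,Y)$ be real-valued random variables whose joint law is given by a prior density $p_X$ and a parameterized family of conditional densities $\{p_{Y|X}(\cdot\,|\,x)\}_{x\in\mathbb{R}}$, satisfying the standing regularity assumptions listed in the context. Let $\varphi(x,y)=\frac{\partial}{\partial y}\log p_{Y|X}(y\,|\,x)$. Then $$J_b(X;Y)=\mathrm{mmse}_b\big(\varphi(X,Y)\,\big|\,Y\big).$$
   Context: Generalized Fisher information with respect to $b$: $J_b(Y)=\int_{\mathbb{R}}b(y)\frac{p_Y'(y)^2}{p_Y(y)}\,dy$, where $p_Y$ is the density of $Y$. Conditional Fisher information: $J_b(Y\,|\,X)=\int_{\mathbb{R}}p_X(x)J_b(Y\,|\,X=x)\,dx$, where $J_b(Y\,|\,X=x)$ is the Fisher information with respect to $b$ of the density $p_{Y|X}(\cdot\,|\,x)$. Mutual Fisher information: $J_b(X;Y)=J_b(Y\,|\,X)-J_b(Y)$. Weighted minimum mean square error of estimating $U$ from $V$: $\mathrm{mmse}_b(U\,|\,V)=\min_T\mathbb{E}\big[b(V)\,(T(V)-U)^2\big]$, the minimum being over all estimators (measurable functions) $T$. Standing regularity assumptions: all densities are positive, smooth and rapidly decreasing, in the sense that all integrals involved converge, one may differentiate under the integral sign, and integrations by parts have zero boundary terms. *)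

theory Defs
  imports "HOL-Probability.Probability"
begin

definition smooth :: "(real \<Rightarrow> real) \<Rightarrow> bool" where
  "smooth f \<longleftrightarrow> (\<forall>n y. (deriv ^^ n) f differentiable (at y))"

text \<open>
  Throughout, \<open>pX\<close> is the prior density, and \<open>pYX x\<close> is the conditional density of \<open>Y\<close> given
  \<open>X = x\<close>, so \<open>pYX x y\<close> is \<open>p(y | x)\<close>. All densities are with respect to Lebesgue measure.
\<close>

definition marginal :: "(real \<Rightarrow> real) \<Rightarrow> (real \<Rightarrow> real \<Rightarrow> real) \<Rightarrow> real \<Rightarrow> real" where
  "marginal pX pYX y = (LINT x|lborel. pX x * pYX x y)"

definition score :: "(real \<Rightarrow> real \<Rightarrow> real) \<Rightarrow> real \<Rightarrow> real \<Rightarrow> real" where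
  "score pYX x y = deriv (\<lambda>y'. ln (pYX x y')) y"

definition fisher_integrand :: "(real \<Rightarrow> real) \<Rightarrow> (real \<Rightarrow> real) \<Rightarrow> real \<Rightarrow> real" where
  "fisher_integrand b p y = b y * ((deriv p y)\<^sup>2 / p y)"

definition fisher_info :: "(real \<Rightarrow> real) \<Rightarrow> (real \<Rightarrow> real) \<Rightarrow> real" where
  "fisher_info b p = (LINT y|lborel. fisher_integrand b p y)"

definition cond_fisher_info ::
  "(real \<Rightarrow> real) \<Rightarrow> (real \<Rightarrow> real) \<Rightarrow> (real \<Rightarrow> real \<Rightarrow> real) \<Rightarrow> real" where
  "cond_fisher_info b pX pYX = (LINT x|lborel. pX x * fisher_info b (pYX x))"

definition mutual_fisher_info ::
  "(real \<Rightarrow> real) \<Rightarrow> (real \<Rightarrow> real) \<Rightarrow> (real \<Rightarrow> real \<Rightarrow> real) \<Rightarrow> real" where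
  "mutual_fisher_info b pX pYX = cond_fisher_info b pX pYX - fisher_info b (marginal pX pYX)"

text \<open>
  The weighted error of an estimator is a nonnegative extended real, so that estimators with
  divergent error have error \<open>\<infinity>\<close>; a Bochner integral would assign them the value \<open>0\<close>.
  Since \<open>mmse\<close> is an infimum, attainment is a separate claim.
\<close>

definition weighted_mse ::
  "'a measure \<Rightarrow> (real \<Rightarrow> real) \<Rightarrow> ('a \<Rightarrow> real) \<Rightarrow> ('a \<Rightarrow> real) \<Rightarrow> (real \<Rightarrow> real) \<Rightarrow> ennreal" where
  "weighted_mse M b U V T = (\<integral>\<^sup>+\<omega>. ennreal (b (V \<omega>) * (T (V \<omega>) - U \<omega>)\<^sup>2) \<partial>M)"

definition mmse ::
  "'a measure \<Rightarrow> (real \<Rightarrow> real) \<Rightarrow> ('a \<Rightarrow> real) \<Rightarrow> ('a \<Rightarrow> real) \<Rightarrow> ennreal" where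
  "mmse M b U V = (INF T\<in>borel_measurable borel. weighted_mse M b U V T)"

end

theory Submission imports Defs begin

text \<open>
  Under the law of \<open>X\<close> given \<open>Y = y\<close>, differentiating under the integral sign makes the
  conditional mean of the score equal to \<open>deriv pY y / pY y\<close>. Completing the square for each \<open>y\<close>
  and integrating against \<open>b\<close> gives
  \<open>weighted_mse T + J\<^sub>b(Y) = J\<^sub>b(Y|X) + \<integral> b pY (T - deriv pY / pY)\<^sup>2\<close>, and the last term vanishes
  exactly for the best estimator. The identity is stated in the extended nonnegative reals with
  \<open>J\<^sub>b(Y)\<close> added on the left, because the error of an estimator may be infinite.
\<close>

text \<open>Bias-variance decomposition around the mean of \<open>s\<close> under the weight
  \<open>f\<close>, whose total mass need not be 1. The left integral is a quadratic in
  \<open>t\<close>, and adding the quotient on the left completes its square. Both sides are sums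
  because subtraction in \<open>ennreal\<close> is truncated.\<close>

lemma nn_integral_complete_square:
  fixes f s :: "'a \<Rightarrow> real" and t :: real
  assumes f_nonneg: "\<And>x. 0 \<le> f x"
    and f: "integrable M f"
    and sf: "integrable M (\<lambda>x. s x * f x)"
    and ssf: "integrable M (\<lambda>x. (s x)\<^sup>2 * f x)"
    and q_pos: "0 < (LINT x|M. f x)"
  shows "(\<integral>\<^sup>+x. ennreal ((t - s x)\<^sup>2 * f x) \<partial>M)
      + ennreal ((LINT x|M. s x * f x)\<^sup>2 / (LINT x|M. f x))
    = (\<integral>\<^sup>+x. ennreal ((s x)\<^sup>2 * f x) \<partial>M)
      + ennreal ((LINT x|M. f x) * (t - (LINT x|M. s x * f x) / (LINT x|M. f x))\<^sup>2)"
proof -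
  define q r v where "q = (LINT x|M. f x)" and "r = (LINT x|M. s x * f x)"
    and "v = (LINT x|M. (s x)\<^sup>2 * f x)"
  have expand: "(t - s x)\<^sup>2 * f x = (s x)\<^sup>2 * f x - 2 * t * (s x * f x) + t\<^sup>2 * f x" for x
    by (simp add: power2_eq_square algebra_simps)
  have int: "integrable M (\<lambda>x. (t - s x)\<^sup>2 * f x)"
    unfolding expand using f sf ssf by simp
  have val: "(LINT x|M. (t - s x)\<^sup>2 * f x) = v - 2 * t * r + t\<^sup>2 * q"
    unfolding expand v_def r_def q_def using f sf ssf by simp
  have "0 \<le> v - 2 * t * r + t\<^sup>2 * q"
    unfolding val[symmetric] by (intro integral_nonneg_AE AE_I2) (simp add: f_nonneg)
  moreover have "0 \<le> v"
    unfolding v_def by (intro integral_nonneg_AE AE_I2) (simp add: f_nonneg)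
  moreover have "0 < q"
    using q_pos by (simp add: q_def)
  moreover from this have "v - 2 * t * r + t\<^sup>2 * q + r\<^sup>2 / q = v + q * (t - r / q)\<^sup>2"
    by (simp add: power2_eq_square field_simps)
  ultimately have "ennreal (v - 2 * t * r + t\<^sup>2 * q) + ennreal (r\<^sup>2 / q)
      = ennreal v + ennreal (q * (t - r / q)\<^sup>2)"
    by (simp add: ennreal_plus[symmetric] del: ennreal_plus)
  moreover have "(\<integral>\<^sup>+x. ennreal ((t - s x)\<^sup>2 * f x) \<partial>M) = ennreal (v - 2 * t * r + t\<^sup>2 * q)"
    unfolding val[symmetric] by (intro nn_integral_eq_integral int AE_I2) (simp add: f_nonneg)
  moreover have "(\<integral>\<^sup>+x. ennreal ((s x)\<^sup>2 * f x) \<partial>M) = ennreal v"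
    unfolding v_def by (intro nn_integral_eq_integral ssf AE_I2) (simp add: f_nonneg)
  ultimately show ?thesis
    by (simp add: q_def r_def)
qed

text \<open>The derivative is a pointwise limit of difference quotients along a fixed sequence of
  steps, and each quotient is jointly measurable. Tonelli needs this joint measurability for the
  score.\<close>

lemma borel_measurable_deriv_snd:
  fixes f :: "'a \<Rightarrow> real \<Rightarrow> real"
  assumes meas: "(\<lambda>(x, y). f x y) \<in> borel_measurable (M \<Otimes>\<^sub>M borel)"
    and diff: "\<And>x y. f x differentiable (at y)"
  shows "(\<lambda>(x, y). deriv (f x) y) \<in> borel_measurable (M \<Otimes>\<^sub>M borel)"
proof (rule borel_measurable_LIMSEQ_real)
  let ?h = "\<lambda>n. inverse (real (Suc n))"
  show "(\<lambda>n. case z of (x, y) \<Rightarrow> (f x (y + ?h n) - f x y) / ?h n)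
      \<longlonglongrightarrow> (case z of (x, y) \<Rightarrow> deriv (f x) y)" for z
  proof (cases z)
    case (Pair x y)
    have "DERIV (f x) y :> deriv (f x) y"
      using diff by (simp add: DERIV_deriv_iff_real_differentiable)
    then have "((\<lambda>h. (f x (y + h) - f x y) / h) \<longlongrightarrow> deriv (f x) y) (at 0)"
      by (simp add: DERIV_def)
    \<comment> \<open>The filter \<open>at 0\<close> excludes 0 itself, so the steps must be
      nonzero; this is why they are inverses of \<open>Suc n\<close>.\<close>
    moreover have "filterlim ?h (at 0) sequentially"
      unfolding filterlim_at using LIMSEQ_inverse_real_of_nat by auto
    ultimately show ?thesis
      using Pair by (auto dest: filterlim_compose)
  qed
next
  fix n
  have "(\<lambda>z. f (fst z) (snd z + c)) \<in> borel_measurable (M \<Otimes>\<^sub>M borel)" for c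
    using measurable_compose[OF _ meas, of "\<lambda>z. (fst z, snd z + c)" "M \<Otimes>\<^sub>M borel"]
    by simp
  \<comment> \<open>The shift by 0 gives the measurability of the second term of the
    quotient.\<close>
  note this[measurable] this[of 0, simplified, measurable]
  show "(\<lambda>(x, y). (f x (y + inverse (real (Suc n))) - f x y) / inverse (real (Suc n)))
      \<in> borel_measurable (M \<Otimes>\<^sub>M borel)"
    unfolding case_prod_beta by measurable
qed

lemma smooth_imp_DERIV:
  assumes "smooth f"
  shows "DERIV f y :> deriv f y"
proof -
  have "(deriv ^^ 0) f differentiable (at y)"
    using assms unfolding smooth_def by blast
  then show ?thesis
    by (simp add: DERIV_deriv_iff_real_differentiable)
qed

text \<open>Nonnegativity is a separate conjunct because \<open>ennreal\<close> maps negative reals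
  to 0. The last conjunct turns the infimum into a minimum.\<close>

theorem theorem4:
  fixes M :: "'a measure"
    and X Y :: "'a \<Rightarrow> real"
    and b pX :: "real \<Rightarrow> real"
    and pYX :: "real \<Rightarrow> real \<Rightarrow> real"
  assumes "prob_space M"
    and b_pos: "\<And>y. 0 < b y"
    and b_meas: "b \<in> borel_measurable borel"
    and pX_pos: "\<And>x. 0 < pX x"
    and pYX_pos: "\<And>x y. 0 < pYX x y"
    and pX_smooth: "smooth pX"
    and pYX_smooth: "\<And>x. smooth (pYX x)"
    and pY_smooth: "smooth (marginal pX pYX)"
    and pX_density: "has_bochner_integral lborel pX 1"
    and pYX_density: "\<And>x. has_bochner_integral lborel (pYX x) 1"
    and pYX_meas: "(\<lambda>(x, y). pYX x y) \<in> borel_measurable (lborel \<Otimes>\<^sub>M lborel)"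
    and joint_law: "distributed M (lborel \<Otimes>\<^sub>M lborel) (\<lambda>\<omega>. (X \<omega>, Y \<omega>))
                      (\<lambda>(x, y). ennreal (pX x * pYX x y))"
    and pY_converges: "\<And>y. integrable lborel (\<lambda>x. pX x * pYX x y)"
    and pY_deriv_converges: "\<And>y. integrable lborel (\<lambda>x. pX x * deriv (pYX x) y)"
    and diff_under_integral:
      "\<And>y. (marginal pX pYX has_real_derivative (LINT x|lborel. pX x * deriv (pYX x) y)) (at y)"
    and fisher_Y_converges: "integrable lborel (fisher_integrand b (marginal pX pYX))"
    and fisher_YX_converges: "\<And>x. integrable lborel (fisher_integrand b (pYX x))"
    and cond_fisher_converges: "integrable lborel (\<lambda>x. pX x * fisher_info b (pYX x))"
  shows "0 \<le> mutual_fisher_info b pX pYX \<and>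
    ennreal (mutual_fisher_info b pX pYX) = mmse M b (\<lambda>\<omega>. score pYX (X \<omega>) (Y \<omega>)) Y \<and>
    (\<exists>T\<in>borel_measurable borel.
      weighted_mse M b (\<lambda>\<omega>. score pYX (X \<omega>) (Y \<omega>)) Y T
        = mmse M b (\<lambda>\<omega>. score pYX (X \<omega>) (Y \<omega>)) Y)"
proof -
  let ?s = "score pYX"
  let ?f = "\<lambda>x y. pX x * pYX x y"
  let ?q = "marginal pX pYX"
  let ?W = "weighted_mse M b (\<lambda>\<omega>. ?s (X \<omega>) (Y \<omega>)) Y"
  let ?J = "ennreal (fisher_info b ?q)"
  let ?A = "ennreal (cond_fisher_info b pX pYX)"
  let ?E = "\<lambda>T. \<integral>\<^sup>+y. ennreal (b y * (?q y * (T y - deriv ?q y / ?q y)\<^sup>2)) \<partial>lborel"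

  have pYX_DERIV: "DERIV (pYX x) y :> deriv (pYX x) y" for x y
    by (rule smooth_imp_DERIV) (rule pYX_smooth)
  have score_eq: "?s x y = deriv (pYX x) y / pYX x y" for x y
  proof -
    have "DERIV (\<lambda>y. ln (pYX x y)) y :> deriv (pYX x) y / pYX x y"
      using pYX_pos by (auto intro!: derivative_eq_intros pYX_DERIV)
    then show ?thesis
      unfolding score_def by (rule DERIV_imp_deriv)
  qed
  \<comment> \<open>The density cancels the denominator of the score. Integrated over
    \<open>x\<close>, the right side is \<open>deriv ?q y\<close> by \<open>q_deriv\<close>, so the
    conditional mean of the score is \<open>deriv ?q y / ?q y\<close>.\<close>
  have sf_eq: "?s x y * ?f x y = pX x * deriv (pYX x) y" for x y
    using pYX_pos[of x y] by (simp add: score_eq)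
  have ssf_eq: "pX x * fisher_integrand b (pYX x) y = b y * ((?s x y)\<^sup>2 * ?f x y)" for x y
    using pYX_pos[of x y] by (simp add: score_eq fisher_integrand_def power2_eq_square)
  have f_pos: "0 < ?f x y" for x y
    using pX_pos pYX_pos by simp
  have q_deriv: "deriv ?q y = (LINT x|lborel. pX x * deriv (pYX x) y)" for y
    using diff_under_integral by (rule DERIV_imp_deriv)
  have q_pos: "0 < ?q y" for y
  proof -
    \<comment> \<open>The equation holds for no \<open>x\<close>, so it could hold almost everywhere
      only if Lebesgue measure were zero.\<close>
    have "\<not> (AE x in lborel. ?f x y = 0)"
      using pX_pos pYX_pos
      by (simp add: less_imp_neq[symmetric] eventually_False ae_filter_eq_bot_iff)
    then have "(LINT x|lborel. ?f x y) \<noteq> 0"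
      using integral_nonneg_eq_0_iff_AE[OF pY_converges[of y]] f_pos by (simp add: less_imp_le)
    moreover have "0 \<le> (LINT x|lborel. ?f x y)"
      using f_pos by (intro integral_nonneg_AE AE_I2) (simp add: less_imp_le)
    ultimately show ?thesis
      by (simp add: marginal_def)
  qed

  note [measurable] = b_meas
  have pX_meas [measurable]: "pX \<in> borel_measurable borel"
    using pX_density by (auto dest: borel_measurable_has_bochner_integral)
  have pYX_meas' [measurable]: "(\<lambda>(x, y). pYX x y) \<in> borel_measurable (borel \<Otimes>\<^sub>M borel)"
    using pYX_meas by (simp cong: measurable_cong_sets sets_pair_measure_cong)
  have pYX_deriv_meas [measurable]: "(\<lambda>(x, y). deriv (pYX x) y) \<in> borel_measurable (borel \<Otimes>\<^sub>M borel)"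
    using pYX_meas' by (rule borel_measurable_deriv_snd)
      (use pYX_DERIV in \<open>simp add: DERIV_deriv_iff_real_differentiable\<close>)
  have s_meas [measurable]: "(\<lambda>(x, y). ?s x y) \<in> borel_measurable (borel \<Otimes>\<^sub>M borel)"
    unfolding score_eq by measurable
  have q_meas [measurable]: "?q \<in> borel_measurable borel"
    unfolding marginal_def[abs_def] by measurable
  have q_deriv_meas [measurable]: "deriv ?q \<in> borel_measurable borel"
    unfolding q_deriv[abs_def] by measurable

  \<comment> \<open>With \<open>y\<close> outermost, \<open>T y\<close> is a constant in the inner
    integral, as completing the square requires.\<close>
  have W_eq: "?W T = (\<integral>\<^sup>+y. ennreal (b y) * (\<integral>\<^sup>+x. ennreal ((T y - ?s x y)\<^sup>2 * ?f x y) \<partial>lborel) \<partial>lborel)"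
    if [measurable]: "T \<in> borel_measurable borel" for T
  proof -
    have "?W T = (\<integral>\<^sup>+z. (\<lambda>(x, y). ennreal (?f x y)) z
        * (\<lambda>(x, y). ennreal (b y * (T y - ?s x y)\<^sup>2)) z \<partial>(lborel \<Otimes>\<^sub>M lborel))"
      unfolding weighted_mse_def
      by (subst distributed_nn_integral[OF joint_law]) auto
    also have "\<dots> = (\<integral>\<^sup>+z. (\<lambda>(x, y). ennreal (b y * ((T y - ?s x y)\<^sup>2 * ?f x y))) z \<partial>(lborel \<Otimes>\<^sub>M lborel))"
      using f_pos b_pos
      by (intro nn_integral_cong)
        (auto simp: ennreal_mult[symmetric] less_imp_le mult_ac simp del: ennreal_mult)
    also have "\<dots> = (\<integral>\<^sup>+y. \<integral>\<^sup>+x. ennreal (b y * ((T y - ?s x y)\<^sup>2 * ?f x y)) \<partial>lborel \<partial>lborel)"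
      by (subst lborel_pair.nn_integral_snd[symmetric]) auto
    also have "\<dots> = (\<integral>\<^sup>+y. ennreal (b y) * (\<integral>\<^sup>+x. ennreal ((T y - ?s x y)\<^sup>2 * ?f x y) \<partial>lborel) \<partial>lborel)"
      using f_pos b_pos
      by (intro nn_integral_cong, subst nn_integral_cmult[symmetric])
        (auto simp: ennreal_mult less_imp_le)
    finally show ?thesis .
  qed

  have A_eq: "?A = (\<integral>\<^sup>+y. ennreal (b y) * (\<integral>\<^sup>+x. ennreal ((?s x y)\<^sup>2 * ?f x y) \<partial>lborel) \<partial>lborel)"
  proof -
    have fi_nonneg: "0 \<le> fisher_integrand b (pYX x) y" for x y
      using b_pos[of y] pYX_pos[of x y] by (simp add: fisher_integrand_def)
    have inner: "ennreal (pX x * fisher_info b (pYX x))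
        = (\<integral>\<^sup>+y. ennreal (b y * ((?s x y)\<^sup>2 * ?f x y)) \<partial>lborel)" for x
      unfolding fisher_info_def ssf_eq[symmetric] integral_mult_right_zero[symmetric]
      using fisher_YX_converges[of x] fi_nonneg pX_pos[of x]
      by (intro nn_integral_eq_integral[symmetric]) (auto simp: less_imp_le)
    have "?A = (\<integral>\<^sup>+x. ennreal (pX x * fisher_info b (pYX x)) \<partial>lborel)"
      unfolding cond_fisher_info_def
      using pX_pos fi_nonneg
      by (intro nn_integral_eq_integral[symmetric] cond_fisher_converges AE_I2)
        (auto simp: fisher_info_def less_imp_le)
    \<comment> \<open>The conditional information integrates over \<open>y\<close> first; Tonelli
      reverses the order to match \<open>W_eq\<close>.\<close>
    also have "\<dots> = (\<integral>\<^sup>+y. \<integral>\<^sup>+x. ennreal (b y * ((?s x y)\<^sup>2 * ?f x y)) \<partial>lborel \<partial>lborel)"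
      unfolding inner
      by (subst lborel_pair.Fubini'[symmetric]) auto
    also have "\<dots> = (\<integral>\<^sup>+y. ennreal (b y) * (\<integral>\<^sup>+x. ennreal ((?s x y)\<^sup>2 * ?f x y) \<partial>lborel) \<partial>lborel)"
      using f_pos b_pos
      by (intro nn_integral_cong, subst nn_integral_cmult[symmetric])
        (auto simp: ennreal_mult less_imp_le)
    finally show ?thesis .
  qed

  have J_nonneg: "0 \<le> fisher_integrand b ?q y" for y
    using b_pos[of y] q_pos[of y] by (simp add: fisher_integrand_def)
  have J_eq: "?J = (\<integral>\<^sup>+y. ennreal (b y) * ennreal ((deriv ?q y)\<^sup>2 / ?q y) \<partial>lborel)"
  proof -
    have "?J = (\<integral>\<^sup>+y. ennreal (fisher_integrand b ?q y) \<partial>lborel)"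
      unfolding fisher_info_def
      by (intro nn_integral_eq_integral[symmetric] fisher_Y_converges AE_I2 J_nonneg)
    then show ?thesis
      using b_pos by (simp add: fisher_integrand_def less_imp_le flip: ennreal_mult')
  qed

  \<comment> \<open>The double integral in \<open>A_eq\<close> is \<open>ennreal\<close> of a real,
    hence finite, so its integrand in \<open>y\<close> is finite almost everywhere; the factor
    \<open>b y\<close> drops out because it is positive.\<close>
  have finite_AE: "AE y in lborel. (\<integral>\<^sup>+x. ennreal ((?s x y)\<^sup>2 * ?f x y) \<partial>lborel) < \<infinity>"
  proof -
    have "AE y in lborel. ennreal (b y) * (\<integral>\<^sup>+x. ennreal ((?s x y)\<^sup>2 * ?f x y) \<partial>lborel) \<noteq> \<infinity>"
      by (intro nn_integral_PInf_AE) (auto simp flip: A_eq)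
    then show ?thesis
      by eventually_elim
        (auto simp: ennreal_mult_eq_top_iff ennreal_eq_0_iff b_pos[folded not_le] top.not_eq_extremum)
  qed

  have key: "?W T + ?J = ?A + ?E T" if [measurable]: "T \<in> borel_measurable borel" for T
  proof -
    have "?W T + ?J = (\<integral>\<^sup>+y. ennreal (b y) * ((\<integral>\<^sup>+x. ennreal ((T y - ?s x y)\<^sup>2 * ?f x y) \<partial>lborel)
        + ennreal ((deriv ?q y)\<^sup>2 / ?q y)) \<partial>lborel)"
      unfolding W_eq[OF that] J_eq distrib_left by (rule nn_integral_add[symmetric]) measurable
    also have "\<dots> = (\<integral>\<^sup>+y. ennreal (b y) * ((\<integral>\<^sup>+x. ennreal ((?s x y)\<^sup>2 * ?f x y) \<partial>lborel)
        + ennreal (?q y * (T y - deriv ?q y / ?q y)\<^sup>2)) \<partial>lborel)"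
    \<comment> \<open>The square is completed only for almost every \<open>y\<close>: finiteness of
      the second moment of the score is what makes \<open>nn_integral_complete_square\<close>
      applicable.\<close>
    proof (rule nn_integral_cong_AE, use finite_AE in eventually_elim)
      case (elim y)
      have "integrable lborel (\<lambda>x. (?s x y)\<^sup>2 * ?f x y)"
        using elim f_pos by (intro integrableI_nonneg) (auto simp: less_imp_le)
      from nn_integral_complete_square[OF _ pY_converges _ this, of "T y"]
      show ?case
        using f_pos q_pos[of y] pY_deriv_converges[of y]
        by (simp add: sf_eq less_imp_le q_deriv marginal_def)
    qed
    also have "\<dots> = ?A + (\<integral>\<^sup>+y. ennreal (b y) * ennreal (?q y * (T y - deriv ?q y / ?q y)\<^sup>2) \<partial>lborel)"
      unfolding A_eq distrib_left by (rule nn_integral_add) measurable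
    also have "\<dots> = ?A + ?E T"
      using b_pos q_pos by (simp add: ennreal_mult less_imp_le)
    finally show ?thesis .
  qed

  \<comment> \<open>The conditional mean of the score given \<open>y\<close>; it makes the integrand
    of \<open>?E\<close> vanish identically.\<close>
  define T0 where "T0 y = deriv ?q y / ?q y" for y
  have T0_meas [measurable]: "T0 \<in> borel_measurable borel"
    unfolding T0_def by measurable
  have W_T0: "?W T0 + ?J = ?A"
    using key[OF T0_meas] by (simp add: T0_def)
  have T0_min: "?W T0 \<le> ?W T" if "T \<in> borel_measurable borel" for T
  proof -
    \<comment> \<open>By \<open>key\<close>, the two sides differ by \<open>?E T\<close>. The term
      \<open>?J\<close> can then be cancelled because it is finite, even when \<open>?W T\<close> is
      infinite.\<close>
    have "?J + ?W T0 \<le> ?J + ?W T"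
      using key[OF that] W_T0 by (simp add: add.commute)
    then show ?thesis
      by (simp add: ennreal_add_left_cancel_le)
  qed
  have mmse_eq: "mmse M b (\<lambda>\<omega>. ?s (X \<omega>) (Y \<omega>)) Y = ?W T0"
    unfolding mmse_def by (intro antisym INF_lower INF_greatest T0_meas T0_min)
  have "0 \<le> fisher_info b ?q"
    unfolding fisher_info_def by (intro integral_nonneg_AE AE_I2 J_nonneg)
  moreover have "0 \<le> cond_fisher_info b pX pYX"
    unfolding cond_fisher_info_def fisher_info_def fisher_integrand_def
    using pX_pos b_pos pYX_pos
    by (intro integral_nonneg_AE AE_I2 mult_nonneg_nonneg divide_nonneg_pos) (auto simp: less_imp_le)
  \<comment> \<open>Together with nonnegativity of the conditional information, this yields the
    inequality between the underlying reals.\<close>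
  moreover have "?J \<le> ?A"
    unfolding W_T0[symmetric] by simp
  ultimately have "0 \<le> mutual_fisher_info b pX pYX"
    by (simp add: mutual_fisher_info_def)
  moreover have "ennreal (mutual_fisher_info b pX pYX) = ?W T0"
    \<comment> \<open>The difference becomes \<open>?W T0 + ?J - ?J\<close>, where the finite
      \<open>?J\<close> cancels.\<close>
    unfolding mutual_fisher_info_def ennreal_minus[OF \<open>0 \<le> fisher_info b ?q\<close>, symmetric] W_T0[symmetric]
    by simp
  ultimately show ?thesis
    using T0_meas mmse_eq by auto
qed

end
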